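(* Let $(L,\leqslant)$ be an infinite linearly ordered set and $n$ an arbitrary positive integer. Suppose $\mathscr{OI}_n(L)$ is endowed with a Hausdorff topology making it a topological semigroup. Then the Bohr compactification of the Hausdorff topological semigroup $\mathscr{OI}_n(L)$ is the trivial (one-element) semigroup.
   Context: For a linearly ordered set $(L,\leqslant)$, a partial order isomorphism of $L$ is an injective partial map $\alpha$ from $L$ to $L$ (possibly empty) such that for all $x_1,x_2\in\operatorname{dom}\alpha$, $x_1\leqslant x_2$ implies $(x_1)\alpha\leqslant(x_2)\alpha$. $\mathscr{OI}_n(L)$ denotes the set of all partial order isomorphisms $\alpha$ of $L$ with $|\operatorname{dom}\alpha|\leq n$, with the semigroup operation of composition of partial maps: maps are written on the right, $(x)(\alpha\beta)=((x)\alpha)\beta$, and $\operatorname{dom}(\alpha\beta)=\{x\in\operatorname{dom}\alpha:(x)\alpha\in\operatorname{dom}\beta\}$. A topological semigroup is a semigroup with a topology for which the operation is (jointly) continuous. The Bohr compactification of a topological semigroup $S$ is a pair $(\mathfrak{b},\mathbf{B}(S))$ such that $\mathbf{B}(S)$ is a compact Hausdorff topological semigroup, $\mathfrak{b}\colon S\to\mathbf{B}(S)$ is a continuous homomorphism, and for every continuous homomorphism $\mathfrak{g}\colon S\to T$ into a compact Hausdorff topological semigroup $T$ there exists a unique continuous homomorphism $\mathfrak{f}\colon\mathbf{B}(S)\to T$ such that $\mathfrak{g}$ is the composition of $\mathfrak{b}$ followed by $\mathfrak{f}$. *)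

theory Defs
  imports "HOL-Analysis.Analysis"
begin

definition partial_order_iso :: "('a::linorder \<rightharpoonup> 'a) \<Rightarrow> bool" where
  "partial_order_iso \<alpha> \<longleftrightarrow>
     inj_on \<alpha> (dom \<alpha>) \<and>
     (\<forall>x1\<in>dom \<alpha>. \<forall>x2\<in>dom \<alpha>. x1 \<le> x2 \<longrightarrow> the (\<alpha> x1) \<le> the (\<alpha> x2))"

definition OI :: "nat \<Rightarrow> ('a::linorder \<rightharpoonup> 'a) set" where
  "OI n = {\<alpha>. partial_order_iso \<alpha> \<and> finite (dom \<alpha>) \<and> card (dom \<alpha>) \<le> n}"

text \<open>Maps act on the right: first \<open>\<alpha>\<close>, then \<open>\<beta>\<close>.\<close>

definition pcomp :: "('a \<rightharpoonup> 'a) \<Rightarrow> ('a \<rightharpoonup> 'a) \<Rightarrow> ('a \<rightharpoonup> 'a)" where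
  "pcomp \<alpha> \<beta> = \<beta> \<circ>\<^sub>m \<alpha>"

definition semigroup_on :: "'s set \<Rightarrow> ('s \<Rightarrow> 's \<Rightarrow> 's) \<Rightarrow> bool" where
  "semigroup_on S m \<longleftrightarrow>
     (\<forall>x\<in>S. \<forall>y\<in>S. m x y \<in> S) \<and>
     (\<forall>x\<in>S. \<forall>y\<in>S. \<forall>z\<in>S. m (m x y) z = m x (m y z))"

definition topological_semigroup :: "'s topology \<Rightarrow> ('s \<Rightarrow> 's \<Rightarrow> 's) \<Rightarrow> bool" where
  "topological_semigroup X m \<longleftrightarrow>
     semigroup_on (topspace X) m \<and>
     continuous_map (prod_topology X X) X (\<lambda>(x, y). m x y)"

definition compact_Hausdorff_semigroup :: "'s topology \<Rightarrow> ('s \<Rightarrow> 's \<Rightarrow> 's) \<Rightarrow> bool" where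
  "compact_Hausdorff_semigroup X m \<longleftrightarrow>
     topological_semigroup X m \<and> compact_space X \<and> Hausdorff_space X"

definition continuous_hom ::
  "'s topology \<Rightarrow> ('s \<Rightarrow> 's \<Rightarrow> 's) \<Rightarrow> 't topology \<Rightarrow> ('t \<Rightarrow> 't \<Rightarrow> 't) \<Rightarrow> ('s \<Rightarrow> 't) \<Rightarrow> bool" where
  "continuous_hom X m Y k f \<longleftrightarrow>
     continuous_map X Y f \<and>
     (\<forall>x\<in>topspace X. \<forall>y\<in>topspace X. f (m x y) = k (f x) (f y))"

text \<open>
  The pair \<open>(\<bb>, (B, k))\<close> is a Bohr compactification of \<open>(X, m)\<close>, tested against all compact
  Hausdorff topological semigroups with carrier in the type \<open>'t\<close>. HOL cannot quantify over types
  inside a formula, so \<open>'t\<close> is a parameter. In a conclusion, a free \<open>'t\<close> gives the full universal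
  property. As a hypothesis, a fixed \<open>'t\<close> demands only part of it, so that the result proved is
  stronger. Uniqueness of \<open>f\<close> is uniqueness on the carrier, hence \<open>extensional\<close>.
\<close>

definition Bohr_compactification ::
  "'t itself \<Rightarrow> 's topology \<Rightarrow> ('s \<Rightarrow> 's \<Rightarrow> 's)
    \<Rightarrow> ('s \<Rightarrow> 'b) \<Rightarrow> 'b topology \<Rightarrow> ('b \<Rightarrow> 'b \<Rightarrow> 'b) \<Rightarrow> bool" where
  "Bohr_compactification TYPE('t) X m \<bb> B k \<longleftrightarrow>
     compact_Hausdorff_semigroup B k \<and>
     continuous_hom X m B k \<bb> \<and>
     (\<forall>(T :: 't topology) l g.
        compact_Hausdorff_semigroup T l \<and> continuous_hom X m T l g \<longrightarrow>
        (\<exists>!f. f \<in> extensional (topspace B) \<and> continuous_hom B k T l f \<and>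
              (\<forall>x\<in>topspace X. f (\<bb> x) = g x)))"

end

theory Submission imports Defs begin

text \<open>
  Every continuous homomorphism \<open>g\<close> from \<open>OI n\<close> into a compact Hausdorff semigroup \<open>T\<close> is
  constant, with the value \<open>g Map.empty\<close>. This carries the whole theorem: it makes the
  one-element semigroup a Bohr compactification, and it forces any other Bohr compactification
  \<open>B\<close> to be trivial, because both the identity of \<open>B\<close> and the constant map at
  \<open>\<bb> Map.empty\<close> extend \<open>\<bb>\<close>.

  The reason is that matrix units indexed by an infinite set collapse in a compact semigroup.
  Let \<open>A\<close> be a finite domain with \<open>k\<close> elements. As the chain is infinite, it contains
  infinitely many pairwise disjoint \<open>k\<close>-element sets \<open>A 0, A 1, \<dots>\<close>. Let \<open>u i\<close> be the order
  isomorphism from \<open>A\<close> onto \<open>A i\<close> and \<open>v i\<close> its inverse. Then \<open>u i\<close> followed by \<open>v i\<close> is the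
  identity of \<open>A\<close>, while \<open>u i\<close> followed by \<open>v j\<close> is empty for \<open>i \<noteq> j\<close>. At a cluster point
  \<open>(p, q)\<close> of the pairs \<open>(g (u i), g (v i))\<close> in \<open>T \<times> T\<close>, the product of \<open>p\<close> and \<open>q\<close> is approximated
  by the first kind of product and by the second kind, so \<open>g\<close> takes the same value at the identity
  of \<open>A\<close> and at the empty map (\<open>compact_Hausdorff_matrix_units_collapse\<close>). Multiplying by an
  arbitrary element with domain \<open>A\<close> gives the claim. Choosing the sets \<open>A i\<close> disjoint, and not
  merely distinct, avoids an induction on the rank.
\<close>

section \<open>Matrix units in compact Hausdorff semigroups\<close>

text \<open>
  Otherwise each point of \<open>T \<times> T\<close> has a neighbourhood on which the multiplication avoids \<open>a\<close> or
  avoids \<open>b\<close>. Such a neighbourhood contains a box, and a box contains \<open>(u i, v i)\<close> for at most one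
  \<open>i\<close>. Finitely many of these boxes cover \<open>T \<times> T\<close>, although there are infinitely many indices.
\<close>

lemma compact_Hausdorff_matrix_units_collapse:
  fixes u v :: "nat \<Rightarrow> 't"
  assumes T: "compact_Hausdorff_semigroup T m"
    and u: "\<And>i. u i \<in> topspace T" and v: "\<And>i. v i \<in> topspace T"
    and diag: "\<And>i. m (u i) (v i) = a"
    and off: "\<And>i j. i \<noteq> j \<Longrightarrow> m (u i) (v j) = b"
  shows "a = b"
proof (rule ccontr)
  assume "a \<noteq> b"
  let ?P = "prod_topology T T"
  have cont: "continuous_map ?P T (\<lambda>(x, y). m x y)"
    and "compact_space T" and "Hausdorff_space T"
    using T by (auto simp: compact_Hausdorff_semigroup_def topological_semigroup_def)
  then have comp: "compact_space ?P" and t1: "t1_space T"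
    by (auto simp: compact_space_prod_topology Hausdorff_imp_t1_space)
  have box: "\<exists>W. openin ?P W \<and> p \<in> W \<and> finite {i. (u i, v i) \<in> W}" if p: "p \<in> topspace ?P" for p
  proof -
    obtain x y where xy: "p = (x, y)" by (cases p)
    obtain c where c: "c = a \<or> c = b" and "m x y \<noteq> c"
      using \<open>a \<noteq> b\<close> by metis
    have "openin T (topspace T - {c})"
      using t1 by (metis Diff_insert_absorb openin_topspace t1_space_openin_delete_alt)
    then have "openin ?P {q \<in> topspace ?P. (\<lambda>(x, y). m x y) q \<in> topspace T - {c}}"
      using cont by (rule openin_continuous_map_preimage[rotated])
    moreover have "p \<in> {q \<in> topspace ?P. (\<lambda>(x, y). m x y) q \<in> topspace T - {c}}"
      using p \<open>m x y \<noteq> c\<close> continuous_map_funspace[OF cont] by (auto simp: xy dest: Pi_mem)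
    ultimately obtain U V where U: "openin T U" and V: "openin T V" and pUV: "x \<in> U" "y \<in> V"
      and sub: "U \<times> V \<subseteq> {q \<in> topspace ?P. (\<lambda>(x, y). m x y) q \<in> topspace T - {c}}"
      unfolding openin_prod_topology_alt xy by meson
    have avoid: "m s t \<noteq> c" if "s \<in> U" "t \<in> V" for s t
      using sub that by auto
    have "i = j" if "(u i, v i) \<in> U \<times> V" "(u j, v j) \<in> U \<times> V" for i j
      using c avoid[of "u i" "v i"] avoid[of "u i" "v j"] that diag[of i] off[of i j] by auto
    then have "{i. (u i, v i) \<in> U \<times> V} \<subseteq> {i}" if "(u i, v i) \<in> U \<times> V" for i
      using that by blast
    then have "finite {i. (u i, v i) \<in> U \<times> V}"
      by (metis (no_types, lifting) Collect_empty_eq finite.emptyI finite.insertI finite_subset)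
    then show ?thesis
      using U V pUV xy by (intro exI[of _ "U \<times> V"]) (auto simp: openin_prod_Times_iff)
  qed
  then obtain W where W: "\<And>p. p \<in> topspace ?P \<Longrightarrow>
      openin ?P (W p) \<and> p \<in> W p \<and> finite {i. (u i, v i) \<in> W p}"
    by metis
  obtain F where F: "finite F" "F \<subseteq> W ` topspace ?P" "topspace ?P \<subseteq> \<Union>F"
    using comp[unfolded compact_space_alt, rule_format, of "W ` topspace ?P"] W by blast
  have "UNIV = (\<Union>E\<in>F. {i. (u i, v i) \<in> E})"
    using F(3) u v by (fastforce simp: subset_iff)
  moreover have "finite (\<Union>E\<in>F. {i. (u i, v i) \<in> E})"
    using F(1,2) W by auto
  ultimately show False by (metis infinite_UNIV_nat)
qed

section \<open>Order isomorphisms between finite sets\<close>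

text \<open>
  Finite subsets of the chain are given by their increasing enumerations; \<open>enum_iso k e f\<close> is the
  matrix unit at the position of two such subsets.
\<close>

definition enum_iso :: "nat \<Rightarrow> (nat \<Rightarrow> 'a) \<Rightarrow> (nat \<Rightarrow> 'a) \<Rightarrow> ('a \<rightharpoonup> 'a)" where
  "enum_iso k e f =
     (\<lambda>x. if x \<in> e ` {..<k} then Some (f (inv_into {..<k} e x)) else None)"

lemma dom_enum_iso: "dom (enum_iso k e f) = e ` {..<k}"
  by (auto simp: enum_iso_def split: if_splits)

lemma enum_iso_apply:
  assumes "inj_on e {..<k}" and "i < k"
  shows "enum_iso k e f (e i) = Some (f i)"
  using assms by (simp add: enum_iso_def)

lemma enum_iso_in_OI:
  fixes e f :: "nat \<Rightarrow> 'a::linorder"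
  assumes e: "strict_mono_on {..<k} e" and f: "strict_mono_on {..<k} f" and "k \<le> n"
  shows "enum_iso k e f \<in> OI n"
proof -
  have inj: "inj_on e {..<k}" "inj_on f {..<k}"
    using e f by (simp_all add: strict_mono_on_imp_inj_on)
  have "inj_on (enum_iso k e f) (e ` {..<k})"
    using inj by (auto simp: inj_on_def enum_iso_apply)
  moreover have "the (enum_iso k e f (e i)) \<le> the (enum_iso k e f (e j))"
    if "i < k" "j < k" "e i \<le> e j" for i j
    using that inj e f
    by (simp add: enum_iso_apply strict_mono_on_less_eq)
  moreover have "card (e ` {..<k}) \<le> n"
    using inj \<open>k \<le> n\<close> by (simp add: card_image)
  ultimately show ?thesis
    by (auto simp: OI_def partial_order_iso_def dom_enum_iso)
qed

lemma pcomp_enum_iso_same: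
  assumes "inj_on e {..<k}" and "inj_on f {..<k}"
  shows "pcomp (enum_iso k e f) (enum_iso k f e) = (\<lambda>x. if x \<in> e ` {..<k} then Some x else None)"
proof
  show "pcomp (enum_iso k e f) (enum_iso k f e) x = (if x \<in> e ` {..<k} then Some x else None)" for x
  proof (cases "x \<in> e ` {..<k}")
    case True
    then obtain i where "i < k" and "x = e i" by blast
    then show ?thesis
      using assms by (simp add: pcomp_def map_comp_def enum_iso_apply)
  next
    case False
    then show ?thesis
      by (simp add: pcomp_def map_comp_def enum_iso_def)
  qed
qed

lemma pcomp_enum_iso_disjoint:
  assumes "f ` {..<k} \<inter> f' ` {..<k} = {}"
  shows "pcomp (enum_iso k e f) (enum_iso k f' e) = Map.empty"
proof -
  have "f (inv_into {..<k} e x) \<notin> f' ` {..<k}" if "x \<in> e ` {..<k}" for x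
    using that assms inv_into_into[OF that] by blast
  then show ?thesis
    by (simp add: pcomp_def map_comp_def fun_eq_iff enum_iso_def)
qed

lemma strict_mono_enumeration:
  fixes A :: "'a::linorder set"
  assumes "finite A" and "card A = k"
  obtains e where "strict_mono_on {..<k} e" and "e ` {..<k} = A"
proof
  let ?xs = "sorted_list_of_set A"
  show "strict_mono_on {..<k} ((!) ?xs)"
    using assms by (auto simp: strict_mono_on_def intro: sorted_wrt_nth_less)
  show "(!) ?xs ` {..<k} = A"
    using assms by (simp add: nth_image lessThan_atLeast0)
qed

lemma disjoint_sets_of_card:
  assumes "infinite (UNIV :: 'a set)"
  obtains A :: "nat \<Rightarrow> 'a set"
  where "\<And>i. finite (A i)" and "\<And>i. card (A i) = k" and "\<And>i j. i \<noteq> j \<Longrightarrow> A i \<inter> A j = {}"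
proof -
  obtain h :: "nat \<Rightarrow> 'a" where h: "inj h"
    using assms infinite_countable_subset by blast
  \<comment> \<open>The \<open>i\<close>-th block of \<open>k\<close> consecutive indices consists of the \<open>r\<close> with \<open>r div k = i\<close>.\<close>
  define A where "A i = h ` {i * k..<Suc i * k}" for i
  show ?thesis
  proof
    show "finite (A i)" for i by (simp add: A_def)
    show "card (A i) = k" for i
      using h by (simp add: A_def card_image inj_on_subset)
    show "A i \<inter> A j = {}" if "i \<noteq> j" for i j
    proof -
      have "r div k = i" if "r \<in> {i * k..<Suc i * k}" for r i
        using that by (intro div_nat_eqI) (auto simp: mult.commute)
      then have "{i * k..<Suc i * k} \<inter> {j * k..<Suc j * k} = {}"
        using \<open>i \<noteq> j\<close> by blast
      then show ?thesis
        using h by (simp add: A_def flip: image_Int)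
    qed
  qed
qed

section \<open>Homomorphisms to compact Hausdorff semigroups are constant\<close>

lemma empty_in_OI: "Map.empty \<in> OI n"
  by (simp add: OI_def partial_order_iso_def)

lemma OI_hom_constant:
  fixes X :: "('a::linorder \<rightharpoonup> 'a) topology"
  assumes inf: "infinite (UNIV :: 'a set)"
    and X: "topspace X = OI n"
    and T: "compact_Hausdorff_semigroup T m"
    and g: "continuous_hom X pcomp T m g"
    and \<alpha>: "\<alpha> \<in> OI n"
  shows "g \<alpha> = g Map.empty"
proof -
  define k where "k = card (dom \<alpha>)"
  have "finite (dom \<alpha>)" and "k \<le> n"
    using \<alpha> by (auto simp: OI_def k_def)
  have hom: "g (pcomp \<beta> \<gamma>) = m (g \<beta>) (g \<gamma>)" if "\<beta> \<in> OI n" "\<gamma> \<in> OI n" for \<beta> \<gamma>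
    using g that by (simp add: continuous_hom_def X)
  have g_in: "g \<beta> \<in> topspace T" if "\<beta> \<in> OI n" for \<beta>
    using g that X by (auto simp: continuous_hom_def continuous_map_def)
  obtain e where e: "strict_mono_on {..<k} e" "e ` {..<k} = dom \<alpha>"
    using strict_mono_enumeration[OF \<open>finite (dom \<alpha>)\<close>] k_def by metis
  obtain A :: "nat \<Rightarrow> 'a set" where A: "\<And>i. finite (A i)" "\<And>i. card (A i) = k"
      "\<And>i j. i \<noteq> j \<Longrightarrow> A i \<inter> A j = {}"
    using disjoint_sets_of_card[OF inf] by metis
  have "\<exists>f. strict_mono_on {..<k} f \<and> f ` {..<k} = A i" for i
    using strict_mono_enumeration[OF A(1,2)] by metis
  then obtain f where f: "\<And>i. strict_mono_on {..<k} (f i)" "\<And>i. f i ` {..<k} = A i"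
    by metis
  have inj: "inj_on e {..<k}" "\<And>i. inj_on (f i) {..<k}"
    using e f by (simp_all add: strict_mono_on_imp_inj_on)
  have unit_in: "enum_iso k e (f i) \<in> OI n" "enum_iso k (f i) e \<in> OI n" for i
    using e f \<open>k \<le> n\<close> by (simp_all add: enum_iso_in_OI)
  define \<epsilon> where "\<epsilon> = (\<lambda>x. if x \<in> dom \<alpha> then Some x else None)"
  have diag: "pcomp (enum_iso k e (f i)) (enum_iso k (f i) e) = \<epsilon>" for i
    using pcomp_enum_iso_same[OF inj] by (simp add: \<epsilon>_def e)
  have off: "pcomp (enum_iso k e (f i)) (enum_iso k (f j) e) = Map.empty" if "i \<noteq> j" for i j
    using that by (intro pcomp_enum_iso_disjoint) (simp add: f A)
  have "g \<epsilon> = g Map.empty"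
    by (rule compact_Hausdorff_matrix_units_collapse[OF T,
          of "\<lambda>i. g (enum_iso k e (f i))" "\<lambda>i. g (enum_iso k (f i) e)"])
      (simp_all add: g_in unit_in diag off flip: hom)
  moreover have "\<epsilon> \<in> OI n"
    using \<alpha> by (auto simp: \<epsilon>_def OI_def partial_order_iso_def inj_on_def dom_def)
  moreover have "pcomp \<epsilon> \<alpha> = \<alpha>"
    by (auto simp: pcomp_def map_comp_def \<epsilon>_def fun_eq_iff domIff)
  moreover have "pcomp Map.empty \<alpha> = Map.empty"
    by (simp add: pcomp_def)
  ultimately show ?thesis
    by (metis hom empty_in_OI \<alpha>)
qed

lemma OI_hom_empty_idempotent:
  assumes "topspace X = OI n" and "continuous_hom X pcomp T m g"
  shows "g Map.empty \<in> topspace T" and "m (g Map.empty) (g Map.empty) = g Map.empty"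
proof -
  show "g Map.empty \<in> topspace T"
    using assms empty_in_OI by (auto simp: continuous_hom_def continuous_map_def)
  have "g (pcomp Map.empty Map.empty) = m (g Map.empty) (g Map.empty)"
    using assms by (simp add: continuous_hom_def empty_in_OI)
  then show "m (g Map.empty) (g Map.empty) = g Map.empty"
    by (simp add: pcomp_def)
qed

lemma trivial_Bohr_compactification:
  fixes X :: "('a::linorder \<rightharpoonup> 'a) topology"
  assumes inf: "infinite (UNIV :: 'a set)" and X: "topspace X = OI n"
  shows "Bohr_compactification TYPE('t) X pcomp
           (\<lambda>_. ()) (discrete_topology (UNIV :: unit set)) (\<lambda>_ _. ())"
  unfolding Bohr_compactification_def
proof (intro conjI allI impI)
  let ?D = "discrete_topology (UNIV :: unit set)"
  show "compact_Hausdorff_semigroup ?D (\<lambda>_ _. ())"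
    by (auto simp: compact_Hausdorff_semigroup_def topological_semigroup_def semigroup_on_def
        compact_space_discrete_topology case_prod_unfold)
  show "continuous_hom X pcomp ?D (\<lambda>_ _. ()) (\<lambda>_. ())"
    by (simp add: continuous_hom_def)
  fix T :: "'t topology" and l g
  assume Tg: "compact_Hausdorff_semigroup T l \<and> continuous_hom X pcomp T l g"
  then have c: "g Map.empty \<in> topspace T" "l (g Map.empty) (g Map.empty) = g Map.empty"
    using OI_hom_empty_idempotent[OF X] by blast+
  have const: "g x = g Map.empty" if "x \<in> topspace X" for x
    using OI_hom_constant[OF inf X] Tg that X by blast
  show "\<exists>!f. f \<in> extensional (topspace ?D) \<and> continuous_hom ?D (\<lambda>_ _. ()) T l f \<and>
      (\<forall>x\<in>topspace X. f () = g x)"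
  proof (rule ex1I[of _ "\<lambda>_. g Map.empty"])
    show "(\<lambda>_. g Map.empty) \<in> extensional (topspace ?D) \<and>
        continuous_hom ?D (\<lambda>_ _. ()) T l (\<lambda>_. g Map.empty) \<and>
        (\<forall>x\<in>topspace X. g Map.empty = g x)"
      using c const by (auto simp: continuous_hom_def)
    show "f = (\<lambda>_. g Map.empty)"
      if "f \<in> extensional (topspace ?D) \<and> continuous_hom ?D (\<lambda>_ _. ()) T l f \<and>
        (\<forall>x\<in>topspace X. f () = g x)" for f
      using that X empty_in_OI by (auto simp: fun_eq_iff)
  qed
qed

text \<open>
  The universal property is tested against \<open>B\<close> itself and \<open>\<bb>\<close>: the identity and the constant map
  at \<open>\<bb> Map.empty\<close> are both factorizations, the second one because \<open>\<bb> Map.empty\<close> is idempotent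
  and \<open>\<bb>\<close> is constant.
\<close>

lemma Bohr_compactification_trivial:
  fixes X :: "('a::linorder \<rightharpoonup> 'a) topology" and B :: "'b topology"
  assumes inf: "infinite (UNIV :: 'a set)" and X: "topspace X = OI n"
    and Bohr: "Bohr_compactification TYPE('b) X pcomp \<bb> B k"
  shows "topspace B = {\<bb> Map.empty}"
proof -
  let ?e = "\<bb> Map.empty"
  have B: "compact_Hausdorff_semigroup B k" and b: "continuous_hom X pcomp B k \<bb>"
    using Bohr unfolding Bohr_compactification_def by blast+
  then have univ: "\<exists>!f. f \<in> extensional (topspace B) \<and> continuous_hom B k B k f \<and>
              (\<forall>x\<in>topspace X. f (\<bb> x) = \<bb> x)"
    using Bohr unfolding Bohr_compactification_def by blast
  have e: "?e \<in> topspace B" "k ?e ?e = ?e"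
    using OI_hom_empty_idempotent[OF X b] by blast+
  have const: "\<bb> x = ?e" if "x \<in> topspace X" for x
    using OI_hom_constant[OF inf X B b] that X by blast
  have closed: "k x y \<in> topspace B" if "x \<in> topspace B" "y \<in> topspace B" for x y
    using B that
    by (simp add: compact_Hausdorff_semigroup_def topological_semigroup_def semigroup_on_def)
  let ?id = "restrict (\<lambda>x. x) (topspace B)" and ?c = "restrict (\<lambda>_. ?e) (topspace B)"
  have "continuous_map B B ?id" "continuous_map B B ?c"
    using e by (auto intro: continuous_map_eq[of B B "\<lambda>x. x"] continuous_map_eq[of B B "\<lambda>_. ?e"])
  then have "continuous_hom B k B k ?id" "continuous_hom B k B k ?c"
    using e closed by (auto simp: continuous_hom_def)
  moreover have "\<forall>x\<in>topspace X. ?id (\<bb> x) = \<bb> x" "\<forall>x\<in>topspace X. ?c (\<bb> x) = \<bb> x"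
    using e const by simp_all
  ultimately have "?id = ?c"
    using univ by (metis (no_types, lifting) restrict_extensional)
  then have "x = ?e" if "x \<in> topspace B" for x
    using that by (metis restrict_apply')
  then show ?thesis
    using e by blast
qed

theorem mainTheorem4:
  fixes n :: nat and X :: "('a::linorder \<rightharpoonup> 'a) topology"
  assumes "infinite (UNIV :: 'a set)"
    and "n > 0"
    and "topspace X = OI n"
    and "Hausdorff_space X"
    and "topological_semigroup X pcomp"
  shows "Bohr_compactification TYPE('t) X pcomp
           (\<lambda>_. ()) (discrete_topology (UNIV :: unit set)) (\<lambda>_ _. ()) \<and>
         (\<forall>\<bb> (B :: 'b topology) k.
            Bohr_compactification TYPE('b) X pcomp \<bb> B k \<longrightarrow> (\<exists>e. topspace B = {e}))"
  using trivial_Bohr_compactification[OF assms(1,3)]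
    Bohr_compactification_trivial[OF assms(1,3)] by blast

end
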